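(* Let $f\in\mathcal C\setminus\{0\}$. Then the set $\mathcal A(f)$ of all $\mathcal A$-semigroups $S\subseteq\mathcal C$ with $\operatorname{Fb}(S)=f$ is a covariety.
   Context: Notation: $\mathbb N=\{0,1,2,\dots\}$, $p\ge 1$, and $\Lambda=\{e_1,\dots,e_p\}$ is the canonical basis of $\mathbb N^p$. $\mathcal C\subseteq\mathbb N^p$ is a fixed non-negative integer cone (the set of points of $\mathbb N^p$ lying in a finitely generated rational convex cone), with at least $p$ extremal rays. A $\mathcal C$-semigroup is a finitely generated submonoid $S\subseteq\mathcal C$ of $\mathbb N^p$ such that the minimal integer cone containing $S$ is $\mathcal C$ and $\mathcal H(S)=\mathcal C\setminus S$ is finite. A monomial order $\preceq$ on $\mathbb N^p$ is fixed: a total order compatible with addition with $0\preceq x$ for all $x$; it is assumed that $\{x\in\mathcal C\mid x\preceq k\}$ is finite for every $k\in\mathcal C$. The Frobenius element of $S$ is $\operatorname{Fb}(S)=\max_\preceq\mathcal H(S)$ (and $\operatorname{Fb}(S)=-\sum_i e_i$ if $\mathcal H(S)=\emptyset$). $\operatorname{N}(S)=\{x\in S\mid x\prec\operatorname{Fb}(S)\}$. The multiplicity is $\operatorname{m}(S)=\min_\preceq(S\setminus\{0\})$. A $\mathcal C$-semigroup $S$ is an $\mathcal A$-semigroup if for every $s\in S$ and $e\in\Lambda$ the set $\{s,s+e\}$ is not contained in $\operatorname{N}(S)$. A covariety is a non-empty family $V$ of $\mathcal C$-semigroups such that: (i) $V$ has a minimum element with respect to inclusion, denoted $\min_\subseteq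 V$; (ii) if $S,T\in V$ then $S\cap T\in V$; (iii) if $S\in V\setminus\{\min_\subseteq V\}$ then $S\setminus\{\operatorname{m}(S)\}\in V$. *)

theory Defs
  imports "HOL-Analysis.Analysis"
begin

definition to_real :: "nat ^ 'p \<Rightarrow> real ^ 'p" where
  "to_real x = (\<chi> i. real (x $ i))"

definition to_int :: "nat ^ 'p \<Rightarrow> int ^ 'p" where
  "to_int x = (\<chi> i. int (x $ i))"

definition canonical_basis :: "(nat ^ 'p) set" where
  "canonical_basis = range (\<lambda>i. axis i 1)"

definition integer_cone :: "(nat ^ 'p) set \<Rightarrow> bool" where
  "integer_cone C \<longleftrightarrow>
     (\<exists>A :: (real ^ 'p) set. finite A \<and> (\<forall>a\<in>A. \<forall>i. a $ i \<in> \<rat>) \<and>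
        C = {x. to_real x \<in> convex_cone hull A})"

text \<open>The extremal rays of \<open>C\<close> are the half-lines from the origin that are faces of the real
  convex cone spanned by \<open>C\<close>. For an integer cone this spanned cone is polyhedral, so there are
  only finitely many of them and \<^const>\<open>card\<close> counts them correctly.\<close>

definition extremal_rays :: "(nat ^ 'p) set \<Rightarrow> (real ^ 'p) set set" where
  "extremal_rays C =
     {r. (\<exists>v. v \<noteq> 0 \<and> r = (\<lambda>t. t *\<^sub>R v) ` {0..}) \<and>
         r face_of (convex_cone hull (to_real ` C))}"

definition submonoid :: "'a::monoid_add set \<Rightarrow> bool" where
  "submonoid S \<longleftrightarrow> 0 \<in> S \<and> (\<forall>x\<in>S. \<forall>y\<in>S. x + y \<in> S)"

definition finitely_generated :: "'a::monoid_add set \<Rightarrow> bool" where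
  "finitely_generated S \<longleftrightarrow> (\<exists>A. finite A \<and> S = submonoid hull A)"

definition minimal_integer_cone :: "(nat ^ 'p) set \<Rightarrow> (nat ^ 'p) set \<Rightarrow> bool" where
  "minimal_integer_cone S C \<longleftrightarrow>
     integer_cone C \<and> S \<subseteq> C \<and> (\<forall>D. integer_cone D \<and> S \<subseteq> D \<longrightarrow> C \<subseteq> D)"

definition holes :: "(nat ^ 'p) set \<Rightarrow> (nat ^ 'p) set \<Rightarrow> (nat ^ 'p) set" where
  "holes C S = C - S"

definition C_semigroup :: "(nat ^ 'p) set \<Rightarrow> (nat ^ 'p) set \<Rightarrow> bool" where
  "C_semigroup C S \<longleftrightarrow>
     submonoid S \<and> finitely_generated S \<and> S \<subseteq> C \<and>
     minimal_integer_cone S C \<and> finite (holes C S)"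

definition monomial_order :: "(nat ^ 'p \<Rightarrow> nat ^ 'p \<Rightarrow> bool) \<Rightarrow> bool" where
  "monomial_order le \<longleftrightarrow>
     class.linorder le (\<lambda>x y. le x y \<and> x \<noteq> y) \<and>
     (\<forall>x y z. le x y \<longrightarrow> le (x + z) (y + z)) \<and>
     (\<forall>x. le 0 x)"

text \<open>A Frobenius element may have negative coordinates (when there are no holes), so it is
  compared with elements of \<open>\<nat>\<^sup>p\<close> via the unique translation-invariant extension of the
  monomial order to \<open>\<int>\<^sup>p\<close>.\<close>

definition int_less ::
    "(nat ^ 'p \<Rightarrow> nat ^ 'p \<Rightarrow> bool) \<Rightarrow> int ^ 'p \<Rightarrow> int ^ 'p \<Rightarrow> bool" where
  "int_less le a b \<longleftrightarrow>
     (\<exists>c u v. a + to_int c = to_int u \<and> b + to_int c = to_int v \<and> le u v \<and> u \<noteq> v)"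

definition Fb ::
    "(nat ^ 'p) set \<Rightarrow> (nat ^ 'p \<Rightarrow> nat ^ 'p \<Rightarrow> bool) \<Rightarrow> (nat ^ 'p) set \<Rightarrow> int ^ 'p" where
  "Fb C le S =
     (if holes C S = {} then - (\<Sum>e\<in>canonical_basis. to_int e)
      else to_int (order.Greatest le (\<lambda>x. x \<in> holes C S)))"

definition N_set ::
    "(nat ^ 'p) set \<Rightarrow> (nat ^ 'p \<Rightarrow> nat ^ 'p \<Rightarrow> bool) \<Rightarrow> (nat ^ 'p) set \<Rightarrow> (nat ^ 'p) set" where
  "N_set C le S = {x \<in> S. int_less le (to_int x) (Fb C le S)}"

definition multiplicity ::
    "(nat ^ 'p \<Rightarrow> nat ^ 'p \<Rightarrow> bool) \<Rightarrow> (nat ^ 'p) set \<Rightarrow> nat ^ 'p" where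
  "multiplicity le S = ord.Least le (\<lambda>x. x \<in> S - {0})"

definition A_semigroup ::
    "(nat ^ 'p) set \<Rightarrow> (nat ^ 'p \<Rightarrow> nat ^ 'p \<Rightarrow> bool) \<Rightarrow> (nat ^ 'p) set \<Rightarrow> bool" where
  "A_semigroup C le S \<longleftrightarrow>
     C_semigroup C S \<and> (\<forall>s\<in>S. \<forall>e\<in>canonical_basis. \<not> {s, s + e} \<subseteq> N_set C le S)"

definition covariety ::
    "(nat ^ 'p) set \<Rightarrow> (nat ^ 'p \<Rightarrow> nat ^ 'p \<Rightarrow> bool) \<Rightarrow> (nat ^ 'p) set set \<Rightarrow> bool" where
  "covariety C le V \<longleftrightarrow>
     V \<noteq> {} \<and> (\<forall>S\<in>V. C_semigroup C S) \<and>
     (\<exists>M\<in>V. (\<forall>S\<in>V. M \<subseteq> S) \<and>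
        (\<forall>S\<in>V. \<forall>T\<in>V. S \<inter> T \<in> V) \<and>
        (\<forall>S\<in>V - {M}. S - {multiplicity le S} \<in> V))"

definition A_family ::
    "(nat ^ 'p) set \<Rightarrow> (nat ^ 'p \<Rightarrow> nat ^ 'p \<Rightarrow> bool) \<Rightarrow> nat ^ 'p \<Rightarrow> (nat ^ 'p) set set" where
  "A_family C le f = {S. A_semigroup C le S \<and> Fb C le S = to_int f}"

end

theory Submission
  imports Defs
begin

text \<open>
  Once the side conditions in the definition of a \<open>C\<close>-semigroup are understood, the covariety
  axioms are short. Let \<open>M\<close> consist of \<open>0\<close> and all points of \<open>C\<close> above \<open>f\<close>. Every semigroup with
  Frobenius element \<open>f\<close> contains \<open>M\<close>, and \<open>M\<close> is itself in the family, since its only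
  element below \<open>f\<close> is \<open>0\<close>. Intersecting two members, or removing the multiplicity \<open>m\<close> of a member
  other than \<open>M\<close>, keeps all points above \<open>f\<close> and still omits \<open>f\<close>, so the Frobenius element stays
  \<open>f\<close>. For the removal this needs \<open>m\<close> to lie below \<open>f\<close>, which holds because a member
  other than \<open>M\<close> has a nonzero element below \<open>f\<close>. The result is a monoid because \<open>m\<close>, being the least
  nonzero element, is not a sum of two others. Finally, the condition on \<open>s\<close> and \<open>s + e\<close> forbids
  configurations in the set of elements below \<open>f\<close>, so it passes to smaller sets.

  The work lies in showing that the new monoids are \<open>C\<close>-semigroups, that is, finitely generated and
  spanning no smaller integer cone than \<open>C\<close>. Both are automatic for a submonoid \<open>S\<close> with finite
  complement in \<open>C\<close> (\<open>C_semigroup_iff_cofinite_submonoid\<close>). No smaller cone contains \<open>S\<close> because some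
  positive multiple of each point of \<open>C\<close> lies in \<open>S\<close>. For finite generation, it is enough that the
  irreducible elements of \<open>S\<close> be finitely many. If there were infinitely many, then
  \<open>integer_cone_infinite_divisibility\<close> would give an irreducible \<open>x\<close> with \<open>x + z\<close> irreducible for
  infinitely many \<open>z\<close> in \<open>C\<close>. Each nonzero such \<open>z\<close> is outside \<open>S\<close>, contradicting the finiteness of the
  complement.

  That divisibility property is a form of Gordan's lemma. A point of \<open>C\<close> is a nonnegative real
  combination of the rational generators of the cone. Taking out integral multiples of the
  generators, cleared of denominators, leaves one of finitely many remainders. Among infinitely many
  points with the same remainder, Dickson's lemma, applied to the coordinates of the point
  \<^emph>\<open>and\<close> to its multiplicities together, finds an increasing sequence. The differences are then
  natural-number points and also nonnegative combinations of the generators, hence in \<open>C\<close>. Because the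
  coordinates take part, generators with negative entries need no
  description of the cone by linear inequalities.
\<close>

section \<open>Dickson's lemma\<close>

text \<open>A sequence has a monotone subsequence. If that one is not increasing, it is a decreasing
  sequence of natural numbers and so constant from the place where it attains its minimum.\<close>

lemma nat_seq_mono_subseq:
  fixes f :: "nat \<Rightarrow> nat"
  shows "\<exists>r :: nat \<Rightarrow> nat. strict_mono r \<and> mono (f \<circ> r)"
proof -
  obtain r where r: "strict_mono r" "monoseq (f \<circ> r)"
    using seq_monosub[of f] by (auto simp: o_def)
  show ?thesis
  proof (cases "incseq (f \<circ> r)")
    case True
    then show ?thesis using r by blast
  next
    case False
    then have dec: "decseq (f \<circ> r)"
      using r(2) by (auto simp: monoseq_iff)
    obtain k where k: "\<And>j. (f \<circ> r) k \<le> (f \<circ> r) j"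
      using ex_has_least_nat[of "\<lambda>_. True" 0 "f \<circ> r"] by auto
    have const: "f (r (k + j)) = f (r k)" for j
      using k[of "k + j"] decseqD[OF dec, of k "k + j"] by simp
    have "strict_mono (\<lambda>j. r (k + j))"
      using r(1) by (simp add: strict_mono_def)
    moreover have "mono (f \<circ> (\<lambda>j. r (k + j)))"
      by (rule monoI) (simp add: const)
    ultimately show ?thesis by blast
  qed
qed

text \<open>Dickson's lemma in the form of simultaneous subsequences: coordinates are treated one after
  another, since thinning out a sequence preserves the monotonicity already achieved.\<close>

lemma dickson_mono_subseq:
  fixes f :: "'i \<Rightarrow> nat \<Rightarrow> nat"
  assumes "finite I"
  shows "\<exists>r :: nat \<Rightarrow> nat. strict_mono r \<and> (\<forall>i\<in>I. mono (f i \<circ> r))"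
  using assms
proof (induction I)
  case empty
  show ?case by (auto intro: exI[of _ id] strict_mono_id)
next
  case (insert i I)
  then obtain r :: "nat \<Rightarrow> nat" where r: "strict_mono r" "\<And>j. j \<in> I \<Longrightarrow> mono (f j \<circ> r)"
    by blast
  obtain q :: "nat \<Rightarrow> nat" where q: "strict_mono q" "mono (f i \<circ> r \<circ> q)"
    using nat_seq_mono_subseq by blast
  have "mono (f j \<circ> r \<circ> q)" if "j \<in> I" for j
    using r(2)[OF that] strict_mono_mono[OF q(1)] by (auto simp: mono_def)
  moreover have "strict_mono (r \<circ> q)"
    using r(1) q(1) by (rule strict_mono_o)
  ultimately show ?case
    using q(2) by (intro exI[of _ "r \<circ> q"]) (simp add: o_assoc del: o_apply)
qed

section \<open>Finite generation of cofinite submonoids of an integer cone\<close>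

lemma to_real_simps [simp]:
  "to_real x $ i = real (x $ i)" "to_real (x + y) = to_real x + to_real y" "to_real 0 = 0"
  by (simp_all add: to_real_def vec_eq_iff)

lemma integer_cone_0: "integer_cone C \<Longrightarrow> 0 \<in> C"
  by (auto simp: integer_cone_def convex_cone_hull_contains_0)

lemma integer_cone_add: "integer_cone C \<Longrightarrow> x \<in> C \<Longrightarrow> y \<in> C \<Longrightarrow> x + y \<in> C"
  by (auto simp: integer_cone_def convex_cone_hull_add)

text \<open>An integer cone is determined by the rays that meet it, because the real cone is closed under
  division by \<open>k\<close>.\<close>

lemma integer_cone_multiple_iff:
  assumes C: "integer_cone C" and k: "k > 0"
  shows "(\<chi> i. k * x $ i) \<in> C \<longleftrightarrow> x \<in> C"
proof -
  obtain A where A: "C = {x. to_real x \<in> convex_cone hull A}"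
    using C by (auto simp: integer_cone_def)
  have eq: "to_real (\<chi> i. k * x $ i) = real k *\<^sub>R to_real x"
    by (simp add: vec_eq_iff)
  have "to_real x \<in> convex_cone hull A" if "real k *\<^sub>R to_real x \<in> convex_cone hull A"
    using convex_cone_hull_mul[OF that, of "1 / real k"] k by simp
  then show ?thesis
    using k by (auto simp: A eq convex_cone_hull_mul)
qed

lemma convex_cone_hull_sum:
  assumes "\<And>a. a \<in> B \<Longrightarrow> 0 \<le> l a" "B \<subseteq> A"
  shows "(\<Sum>a\<in>B. l a *\<^sub>R a) \<in> convex_cone hull A"
  using assms
  by (induction B rule: infinite_finite_induct)
     (auto intro!: convex_cone_hull_add convex_cone_hull_mul simp: convex_cone_hull_contains_0 hull_inc)

lemma convex_cone_hull_finite_coeffs: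
  assumes fin: "finite A" and x: "x \<in> convex_cone hull A"
  obtains l where "\<And>a. a \<in> A \<Longrightarrow> 0 \<le> l a" "x = (\<Sum>a\<in>A. l a *\<^sub>R a)"
proof (cases "A = {}")
  case True
  then show ?thesis using x that by simp
next
  case False
  then obtain c y where "y \<in> convex hull A" "0 \<le> c" "x = c *\<^sub>R y"
    using x by (auto simp: convex_cone_hull_convex_hull_nonempty)
  moreover obtain u where "\<And>a. a \<in> A \<Longrightarrow> 0 \<le> u a" "y = (\<Sum>a\<in>A. u a *\<^sub>R a)"
    using \<open>y \<in> convex hull A\<close> by (auto simp: convex_hull_finite[OF fin])
  ultimately show ?thesis
    by (intro that[of "\<lambda>a. c * u a"]) (auto simp: scaleR_right.sum)
qed

lemma common_denominator:
  assumes "finite Q" "Q \<subseteq> (\<rat> :: real set)"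
  shows "\<exists>d>0::nat. \<forall>q\<in>Q. real d * q \<in> \<int>"
  using assms
proof (induction Q)
  case empty
  show ?case by auto
next
  case (insert q Q)
  then obtain d where d: "d > 0" "\<And>q. q \<in> Q \<Longrightarrow> real d * q \<in> \<int>" by auto
  obtain a b where ab: "b > 0" "q = of_int a / of_int b"
    using insert.prems Rats_cases' by (metis insert_subset)
  have bq: "real (nat b) * q = of_int a" using ab by simp
  have "real (d * nat b) * p \<in> \<int>" if "p \<in> insert q Q" for p
  proof -
    consider "p = q" | "p \<in> Q" using \<open>p \<in> insert q Q\<close> by blast
    then have "real d * (real (nat b) * p) \<in> \<int>"
    proof cases
      case 1
      then show ?thesis by (simp only: bq) (rule Ints_mult[OF Ints_of_nat Ints_of_int])
    next
      case 2
      then show ?thesis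
        using Ints_mult[OF Ints_of_nat[of "nat b"] d(2)[of p]] by (simp add: ac_simps)
    qed
    then show ?thesis by (simp add: ac_simps)
  qed
  then show ?case using d(1) ab(1) by (intro exI[of _ "d * nat b"]) auto
qed

lemma finite_vectors_with_entries_in:
  assumes "finite T"
  shows "finite {v :: 'a ^ 'p. \<forall>i. v $ i \<in> T}"
proof -
  have "{v :: 'a ^ 'p. \<forall>i. v $ i \<in> T} \<subseteq> vec_lambda ` (PiE UNIV (\<lambda>_. T))"
  proof
    fix v :: "'a ^ 'p"
    assume "v \<in> {v. \<forall>i. v $ i \<in> T}"
    then have "vec_nth v \<in> PiE UNIV (\<lambda>_. T)" by auto
    then show "v \<in> vec_lambda ` (PiE UNIV (\<lambda>_. T))"
      by (metis image_eqI vec_nth_inverse)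
  qed
  then show ?thesis
    by (rule finite_subset) (use assms in \<open>simp add: finite_PiE\<close>)
qed

text \<open>Division with remainder by the generators. With \<open>d\<close> a common denominator, each coefficient is
  reduced modulo \<open>d\<close>. The remainder is integral, because both the point and the vectors \<open>d a\<close> are,
  and it is bounded, because its coefficients lie between \<open>0\<close> and \<open>d\<close>.\<close>

lemma rational_cone_remainder:
  fixes A :: "(real ^ 'p) set"
  assumes fin: "finite A" and rat: "\<forall>a\<in>A. \<forall>i. a $ i \<in> \<rat>"
  shows "\<exists>(d :: nat) R. finite R \<and>
    (\<forall>x. to_real x \<in> convex_cone hull A \<longrightarrow>
       (\<exists>n r. r \<in> R \<and> to_real x = (\<Sum>a\<in>A. real (d * n a) *\<^sub>R a) + r))"
proof -
  have "finite (\<Union>a\<in>A. range (($) a))" using fin by auto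
  then obtain d :: nat where d: "d > 0" "\<And>a i. a \<in> A \<Longrightarrow> real d * a $ i \<in> \<int>"
    using common_denominator[of "\<Union>a\<in>A. range (($) a)"] rat by blast
  define B where "B = (\<Sum>a\<in>A. \<Sum>i\<in>UNIV. real d * \<bar>a $ i\<bar>)"
  define R where "R = {v :: real ^ 'p. \<forall>i. v $ i \<in> {k \<in> \<int>. \<bar>k\<bar> \<le> B}}"
  have "finite R"
    unfolding R_def by (intro finite_vectors_with_entries_in finite_abs_int_segment)
  moreover have "\<exists>n r. r \<in> R \<and> to_real x = (\<Sum>a\<in>A. real (d * n a) *\<^sub>R a) + r"
    if x: "to_real x \<in> convex_cone hull A" for x :: "nat ^ 'p"
  proof -
    obtain l where l: "\<And>a. a \<in> A \<Longrightarrow> 0 \<le> l a" "to_real x = (\<Sum>a\<in>A. l a *\<^sub>R a)"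
      using convex_cone_hull_finite_coeffs[OF fin x] by blast
    define n where "n a = nat \<lfloor>l a / real d\<rfloor>" for a
    define r where "r = to_real x - (\<Sum>a\<in>A. real (d * n a) *\<^sub>R a)"
    have bound: "0 \<le> l a - real (d * n a) \<and> l a - real (d * n a) \<le> real d" if "a \<in> A" for a
    proof -
      have "real (n a) = of_int \<lfloor>l a / real d\<rfloor>"
        using l(1)[OF that] d(1) by (simp add: n_def)
      then have "real (n a) \<le> l a / real d" "l a / real d \<le> real (n a) + 1"
        by linarith+
      then show ?thesis using d(1) by (simp add: field_simps)
    qed
    have "r $ i \<in> \<int>" for i
    proof -
      have "real (n a) * (real d * a $ i) \<in> \<int>" if "a \<in> A" for a
        by (rule Ints_mult[OF Ints_of_nat d(2)[OF that]])
      then have "(\<Sum>a\<in>A. real (n a) * (real d * a $ i)) \<in> \<int>"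
        by (rule Ints_sum)
      then show ?thesis
        by (auto simp: r_def ac_simps intro!: Ints_diff)
    qed
    moreover have "\<bar>r $ i\<bar> \<le> B" for i
    proof -
      have "r = (\<Sum>a\<in>A. (l a - real (d * n a)) *\<^sub>R a)"
        by (simp add: r_def l(2) sum_subtractf scaleR_left_diff_distrib)
      then have "\<bar>r $ i\<bar> \<le> (\<Sum>a\<in>A. \<bar>(l a - real (d * n a)) * a $ i\<bar>)"
        by (simp add: sum_abs)
      also have "\<dots> \<le> (\<Sum>a\<in>A. real d * \<bar>a $ i\<bar>)"
        using bound by (intro sum_mono) (auto simp: abs_mult intro!: mult_right_mono)
      also have "\<dots> \<le> B"
        unfolding B_def by (intro sum_mono member_le_sum) auto
      finally show ?thesis .
    qed
    ultimately show ?thesis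
      by (intro exI[of _ n] exI[of _ r]) (auto simp: R_def r_def)
  qed
  ultimately show ?thesis by blast
qed

text \<open>The order \<open>y - x \<in> C\<close> on an integer cone is a well-quasi-order. This is what finite generation
  of the cone would give, but it is directly what cofinite submonoids require.\<close>

lemma integer_cone_infinite_divisibility:
  fixes C :: "(nat ^ 'p) set"
  assumes C: "integer_cone C" and X: "infinite X" "X \<subseteq> C"
  shows "\<exists>x\<in>X. infinite {z\<in>C. x + z \<in> X}"
proof -
  from C obtain A :: "(real ^ 'p) set" where A: "finite A" "\<forall>a\<in>A. \<forall>i. a $ i \<in> \<rat>"
      and C_eq: "C = {x. to_real x \<in> convex_cone hull A}"
    unfolding integer_cone_def by (elim exE conjE)
  obtain d :: nat and R :: "(real ^ 'p) set" where "finite R"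
    and R: "\<And>x. to_real x \<in> convex_cone hull A \<Longrightarrow>
       \<exists>n r. r \<in> R \<and> to_real x = (\<Sum>a\<in>A. real (d * n a) *\<^sub>R a) + r"
    using rational_cone_remainder[OF A] by metis
  have "\<forall>x\<in>X. \<exists>r\<in>R. \<exists>n. to_real x = (\<Sum>a\<in>A. real (d * n a) *\<^sub>R a) + r"
    using R X(2) C_eq by blast
  from pigeonhole_infinite_rel[OF X(1) \<open>finite R\<close> this]
  obtain r where
    inf: "infinite {x \<in> X. \<exists>n. to_real x = (\<Sum>a\<in>A. real (d * n a) *\<^sub>R a) + r}"
    by blast
  then obtain s :: "nat \<Rightarrow> nat ^ 'p" where s: "inj s"
      "range s \<subseteq> {x \<in> X. \<exists>n. to_real x = (\<Sum>a\<in>A. real (d * n a) *\<^sub>R a) + r}"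
    using infinite_countable_subset by blast
  then have "\<forall>k. \<exists>n. to_real (s k) = (\<Sum>a\<in>A. real (d * n a) *\<^sub>R a) + r"
    by blast
  then obtain n where n: "\<And>k. to_real (s k) = (\<Sum>a\<in>A. real (d * n k a) *\<^sub>R a) + r"
    by metis
  (* Monotone point coordinates make the differences natural-number vectors;
     monotone multiplicities put them in the cone. *)
  define g where "g i k = (case i of Inl j \<Rightarrow> s k $ j | Inr a \<Rightarrow> n k a)" for i k
  have "finite ((UNIV :: 'p set) <+> A)" using A(1) by simp
  then obtain q :: "nat \<Rightarrow> nat" where q: "strict_mono q" "\<And>i. i \<in> UNIV <+> A \<Longrightarrow> mono (g i \<circ> q)"
    using dickson_mono_subseq[of "UNIV <+> A" g] by blast
  have s_le: "s (q 0) $ j \<le> s (q k) $ j" for j k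
    using q(2)[of "Inl j"] by (auto simp: mono_def g_def)
  have n_le: "n (q 0) a \<le> n (q k) a" if "a \<in> A" for a k
    using q(2)[of "Inr a"] that by (auto simp: mono_def g_def)
  define z where "z k = s (q k) - s (q 0)" for k
  have sz: "s (q 0) + z k = s (q k)" for k
    using s_le by (simp add: z_def vec_eq_iff)
  have "inj z"
  proof (rule injI)
    fix k m
    assume "z k = z m"
    then have "s (q k) = s (q m)" using sz by metis
    then show "k = m"
      using s(1) q(1) by (metis injD strict_mono_eq)
  qed
  moreover have "z k \<in> C" for k
  proof -
    have "to_real (s (q 0)) + to_real (z k) = to_real (s (q k))"
      using sz[of k] by (metis to_real_simps(2))
    then have "to_real (z k) =
        (\<Sum>a\<in>A. real (d * n (q k) a) *\<^sub>R a) - (\<Sum>a\<in>A. real (d * n (q 0) a) *\<^sub>R a)"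
      by (simp add: n algebra_simps)
    also have "\<dots> = (\<Sum>a\<in>A. real (d * (n (q k) a - n (q 0) a)) *\<^sub>R a)"
      unfolding sum_subtractf[symmetric]
      by (intro sum.cong refl) (simp add: n_le of_nat_diff algebra_simps)
    finally show ?thesis
      by (auto simp: C_eq intro!: convex_cone_hull_sum)
  qed
  moreover have "s (q 0) + z k \<in> X" for k
    using s(2) by (auto simp: sz)
  ultimately have "infinite {z \<in> C. s (q 0) + z \<in> X}"
    by (intro infinite_super[OF _ range_inj_infinite[of z]]) auto
  moreover have "s (q 0) \<in> X" using s(2) by blast
  ultimately show ?thesis by blast
qed

definition irreducibles :: "'a::monoid_add set \<Rightarrow> 'a set" where
  "irreducibles S = {x \<in> S - {0}. \<forall>y\<in>S - {0}. \<forall>z\<in>S - {0}. x \<noteq> y + z}"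

text \<open>Splitting a reducible element lowers the sum of the coordinates, so it ends with
  irreducibles.\<close>

lemma submonoid_generated_by_irreducibles:
  fixes S :: "(nat ^ 'p) set"
  assumes S: "submonoid S"
  shows "S = submonoid hull (irreducibles S)"
proof
  show "submonoid hull (irreducibles S) \<subseteq> S"
    by (rule hull_minimal) (use S in \<open>auto simp: irreducibles_def\<close>)
  have hull: "submonoid (submonoid hull (irreducibles S))"
    by (rule hull_in) (auto simp: submonoid_def)
  have "x \<in> submonoid hull (irreducibles S)" if "x \<in> S" for x
    using that
  proof (induction "\<Sum>i\<in>UNIV. x $ i" arbitrary: x rule: less_induct)
    case less
    consider "x = 0" | "x \<in> irreducibles S"
      | y z where "y \<in> S - {0}" "z \<in> S - {0}" "x = y + z"
      using less.prems by (auto simp: irreducibles_def)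
    then show ?case
    proof cases
      case 1
      then show ?thesis using hull by (simp add: submonoid_def)
    next
      case 2
      then show ?thesis by (rule hull_inc)
    next
      case 3
      have pos: "(\<Sum>i\<in>UNIV. w $ i) > 0" if "w \<noteq> 0" for w :: "nat ^ 'p"
        using that by (auto simp: vec_eq_iff intro!: sum_pos2)
      have "y \<in> submonoid hull (irreducibles S)" "z \<in> submonoid hull (irreducibles S)"
        using 3 pos[of y] pos[of z] by (auto intro!: less.hyps simp: sum.distrib)
      then show ?thesis using hull 3(3) by (auto simp: submonoid_def)
    qed
  qed
  then show "S \<subseteq> submonoid hull (irreducibles S)" by blast
qed

text \<open>If \<open>x\<close> and \<open>x + z\<close> are both irreducible in \<open>S\<close> and \<open>z \<noteq> 0\<close>, then \<open>z\<close> is not in \<open>S\<close>. So infinitely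
  many irreducibles would leave infinitely many holes.\<close>

lemma cofinite_submonoid_finitely_generated:
  fixes C :: "(nat ^ 'p) set"
  assumes C: "integer_cone C" and S: "submonoid S" "S \<subseteq> C" "finite (C - S)"
  shows "finitely_generated S"
proof -
  have "finite (irreducibles S)"
  proof (rule ccontr)
    assume "infinite (irreducibles S)"
    moreover have "irreducibles S \<subseteq> C" using S(2) by (auto simp: irreducibles_def)
    ultimately obtain x where x: "x \<in> irreducibles S"
        and inf: "infinite {z\<in>C. x + z \<in> irreducibles S}"
      using integer_cone_infinite_divisibility[OF C] by blast
    have "{z\<in>C. x + z \<in> irreducibles S} \<subseteq> insert 0 (C - S)"
      using x by (auto simp: irreducibles_def)
    then show False
      using inf S(3) by (meson finite_insert finite_subset)
  qed
  then show ?thesis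
    unfolding finitely_generated_def
    using submonoid_generated_by_irreducibles[OF S(1)] by blast
qed

text \<open>The multiples of a nonzero point of \<open>C\<close> are infinitely many, so one of them avoids the holes;
  an integer cone that contains this multiple contains the point.\<close>

lemma cofinite_minimal_integer_cone:
  fixes C :: "(nat ^ 'p) set"
  assumes C: "integer_cone C" and S: "0 \<in> S" "S \<subseteq> C" "finite (C - S)"
  shows "minimal_integer_cone S C"
  unfolding minimal_integer_cone_def
proof (intro conjI allI impI subsetI)
  fix D x
  assume D: "integer_cone D \<and> S \<subseteq> D" and x: "x \<in> C"
  show "x \<in> D"
  proof (cases "x = 0")
    case True
    then show ?thesis using D integer_cone_0 by blast
  next
    case False
    then obtain i where i: "x $ i \<noteq> 0" by (auto simp: vec_eq_iff)
    define m where "m k = (\<chi> i. Suc k * x $ i)" for k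
    have "inj m"
    proof (rule injI)
      fix k l assume "m k = m l"
      then have "m k $ i = m l $ i" by simp
      then show "k = l" using i by (simp add: m_def)
    qed
    then have "infinite (range m)" by (rule range_inj_infinite)
    then obtain k where "m k \<notin> C - S"
      using S(3) by (meson finite_subset image_subsetI)
    moreover have "m k \<in> C"
      using integer_cone_multiple_iff[OF C, of "Suc k"] x unfolding m_def by blast
    ultimately have "m k \<in> D" using D by blast
    then show ?thesis
      using integer_cone_multiple_iff[of D "Suc k"] D unfolding m_def by blast
  qed
qed (use C S in auto)

lemma C_semigroup_iff_cofinite_submonoid:
  assumes "integer_cone C"
  shows "C_semigroup C S \<longleftrightarrow> submonoid S \<and> S \<subseteq> C \<and> finite (C - S)"
  using assms cofinite_submonoid_finitely_generated cofinite_minimal_integer_cone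
  by (auto simp: C_semigroup_def holes_def submonoid_def)

section \<open>Frobenius elements and the monomial order\<close>

lemma monomial_orderD:
  assumes "monomial_order le"
  shows "le x x" "le x y \<Longrightarrow> le y x \<Longrightarrow> x = y" "le x y \<Longrightarrow> le y z \<Longrightarrow> le x z"
    "le x y \<or> le y x" "le x y \<Longrightarrow> le (x + z) (y + z)" "le 0 x"
proof -
  interpret linorder le "\<lambda>x y. le x y \<and> x \<noteq> y"
    using assms by (simp add: monomial_order_def)
  show "le x x" by (rule order_refl)
  show "le x y \<Longrightarrow> le y x \<Longrightarrow> x = y" by (rule order_antisym)
  show "le x y \<Longrightarrow> le y z \<Longrightarrow> le x z" by (rule order_trans)
  show "le x y \<or> le y x" by (rule linear)
  show "le x y \<Longrightarrow> le (x + z) (y + z)" "le 0 x"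
    using assms by (simp_all add: monomial_order_def)
qed

lemma monomial_order_summand:
  assumes "monomial_order le"
  shows "le x (x + y)"
  using monomial_orderD(5)[OF assms monomial_orderD(6)[OF assms, of y], of x]
  by (simp add: add.commute)

lemma finite_total_has_greatest:
  assumes "finite X" "X \<noteq> {}"
    and trans: "\<And>x y z. R x y \<Longrightarrow> R y z \<Longrightarrow> R x z" and total: "\<And>x y. R x y \<or> R y x"
  shows "\<exists>m\<in>X. \<forall>x\<in>X. R x m"
  using assms(1,2)
proof (induction X rule: finite_ne_induct)
  case (singleton x)
  show ?case using total by blast
next
  case (insert x X)
  then obtain m where "m \<in> X" "\<forall>y\<in>X. R y m" by blast
  then show ?case
    using total[of x m] total[of x x] trans[of _ m x] by blast
qed

text \<open>A monomial order is cancellative because it is total: if \<open>y\<close> were below \<open>x\<close>, adding \<open>c\<close> would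
  put \<open>y + c\<close> below \<open>x + c\<close>. Hence the extension to integer vectors agrees with the given order.\<close>

lemma int_less_to_int_iff:
  assumes le: "monomial_order le"
  shows "int_less le (to_int x) (to_int y) \<longleftrightarrow> le x y \<and> x \<noteq> y"
proof -
  have inj: "to_int u = to_int v \<longleftrightarrow> u = v" for u v :: "nat ^ 'a"
    by (simp add: to_int_def vec_eq_iff)
  have add: "to_int u + to_int v = to_int (u + v)" for u v :: "nat ^ 'a"
    by (simp add: to_int_def vec_eq_iff)
  have "int_less le (to_int x) (to_int y) \<longleftrightarrow> (\<exists>c. le (x + c) (y + c) \<and> x \<noteq> y)"
    by (auto simp: int_less_def add inj)
  also have "\<dots> \<longleftrightarrow> le x y \<and> x \<noteq> y"
  proof
    assume "\<exists>c. le (x + c) (y + c) \<and> x \<noteq> y"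
    then obtain c where c: "le (x + c) (y + c)" and "x \<noteq> y" by blast
    have "\<not> le y x"
    proof
      assume "le y x"
      then have "x + c = y + c"
        by (rule monomial_orderD(2)[OF le c monomial_orderD(5)[OF le]])
      then show False using \<open>x \<noteq> y\<close> by simp
    qed
    then show "le x y \<and> x \<noteq> y"
      using monomial_orderD(4)[OF le, of x y] \<open>x \<noteq> y\<close> by blast
  next
    assume "le x y \<and> x \<noteq> y"
    then show "\<exists>c. le (x + c) (y + c) \<and> x \<noteq> y"
      by (intro exI[of _ 0]) simp
  qed
  finally show ?thesis .
qed

text \<open>The conventional value for a semigroup without holes has negative entries, so it is never the
  image of a natural-number vector and only the maximum of the holes remains.\<close>

lemma Fb_eq_to_int_iff:
  fixes C :: "(nat ^ 'p) set"
  assumes le: "monomial_order le" and fin: "finite (C - S)"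
  shows "Fb C le S = to_int f \<longleftrightarrow> f \<in> C - S \<and> (\<forall>x\<in>C - S. le x f)"
proof (cases "C - S = {}")
  case True
  have "(- (\<Sum>e\<in>canonical_basis. to_int e)) \<noteq> to_int f"
  proof
    assume eq: "- (\<Sum>e\<in>canonical_basis. to_int e) = to_int f"
    obtain i :: 'p where True by simp
    have "finite (canonical_basis :: (nat ^ 'p) set)" by (simp add: canonical_basis_def)
    then have "to_int (axis i 1) $ i \<le> (\<Sum>e\<in>canonical_basis. to_int e $ i)"
      by (intro member_le_sum) (auto simp: to_int_def canonical_basis_def)
    moreover have "- (\<Sum>e\<in>canonical_basis. to_int e $ i) = to_int f $ i"
      using arg_cong[OF eq, of "\<lambda>v. v $ i"] by simp
    ultimately show False by (simp add: to_int_def)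
  qed
  then show ?thesis using True by (auto simp: Fb_def holes_def)
next
  case False
  have order: "class.order le (\<lambda>x y. le x y \<and> x \<noteq> y)"
    using le by (simp add: monomial_order_def class.linorder_def)
  have "\<exists>m\<in>C - S. \<forall>x\<in>C - S. le x m"
    using fin False monomial_orderD(3,4)[OF le] by (rule finite_total_has_greatest)
  then obtain m where m: "m \<in> C - S" "\<And>x. x \<in> C - S \<Longrightarrow> le x m"
    by blast
  have "order.Greatest le (\<lambda>x. x \<in> C - S) = m"
    using order.Greatest_equality[OF order, of "\<lambda>x. x \<in> C - S" m] m by blast
  then have "Fb C le S = to_int m"
    using False by (simp add: Fb_def holes_def)
  moreover have "to_int m = to_int f \<longleftrightarrow> m = f"
    by (simp add: to_int_def vec_eq_iff)
  ultimately show ?thesis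
    using m monomial_orderD(2)[OF le] by auto
qed

text \<open>Only the part of \<open>S\<close> below one nonzero element \<open>k\<close> matters for the minimum, so finiteness of
  that part replaces well-foundedness of the order.\<close>

lemma multiplicity_least:
  assumes le: "monomial_order le" and fin: "finite {x \<in> S. le x k}" and k: "k \<in> S - {0}"
  shows "multiplicity le S \<in> S - {0}" "\<And>x. x \<in> S - {0} \<Longrightarrow> le (multiplicity le S) x"
proof -
  have order: "class.order le (\<lambda>x y. le x y \<and> x \<noteq> y)"
    using le by (simp add: monomial_order_def class.linorder_def)
  have "finite {x \<in> S - {0}. le x k}" "{x \<in> S - {0}. le x k} \<noteq> {}"
    using k monomial_orderD(1)[OF le] by (auto intro: finite_subset[OF _ fin])
  then have "\<exists>m\<in>{x \<in> S - {0}. le x k}. \<forall>x\<in>{x \<in> S - {0}. le x k}. le m x"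
  proof (rule finite_total_has_greatest)
    show "le z x" if "le y x" "le z y" for x y z
      by (rule monomial_orderD(3)[OF le that(2,1)])
    show "le y x \<or> le x y" for x y
      by (rule monomial_orderD(4)[OF le])
  qed
  then obtain m where m: "m \<in> S - {0}" "le m k"
      "\<And>x. x \<in> S - {0} \<Longrightarrow> le x k \<Longrightarrow> le m x"
    by auto
  have least: "le m x" if "x \<in> S - {0}" for x
    using m(3)[OF that] monomial_orderD(4)[OF le, of x k] monomial_orderD(3)[OF le m(2)] by blast
  have "multiplicity le S = m"
    unfolding multiplicity_def
    using order.Least_equality[OF order, of "\<lambda>x. x \<in> S - {0}" m] m(1) least by blast
  then show "multiplicity le S \<in> S - {0}" "\<And>x. x \<in> S - {0} \<Longrightarrow> le (multiplicity le S) x"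
    using m(1) least by auto
qed

section \<open>The covariety\<close>

text \<open>Membership in elementary terms: the holes are confined to the finite set of points below \<open>f\<close>,
  so the geometric conditions disappear, and for elements of \<open>S\<close> being strictly below \<open>f\<close> is the same
  as being below \<open>f\<close>, as \<open>f\<close> is not in \<open>S\<close>. Each remaining condition is visibly stable under
  the operations in question.\<close>

lemma mem_A_family_iff:
  fixes C :: "(nat ^ 'p) set"
  assumes C: "integer_cone C" and le: "monomial_order le"
    and fin: "\<forall>k\<in>C. finite {x \<in> C. le x k}" and f: "f \<in> C"
  shows "S \<in> A_family C le f \<longleftrightarrow>
    submonoid S \<and> S \<subseteq> C \<and> f \<notin> S \<and> (\<forall>x\<in>C - S. le x f) \<and>
    (\<forall>s\<in>S. \<forall>e\<in>canonical_basis. s + e \<in> S \<longrightarrow> le s f \<longrightarrow> \<not> le (s + e) f)"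
    (is "_ \<longleftrightarrow> ?R")
proof -
  have cofinite: "finite (C - S)" if "\<forall>x\<in>C - S. le x f"
    by (rule finite_subset[OF _ bspec[OF fin f]]) (use that in auto)
  let ?A = "\<forall>s\<in>S. \<forall>e\<in>canonical_basis. \<not> {s, s + e} \<subseteq> {x \<in> S. le x f \<and> x \<noteq> f}"
  have "N_set C le S = {x \<in> S. le x f \<and> x \<noteq> f}" if "Fb C le S = to_int f"
    by (simp add: N_set_def that int_less_to_int_iff[OF le])
  then have "S \<in> A_family C le f \<longleftrightarrow> C_semigroup C S \<and> Fb C le S = to_int f \<and> ?A"
    by (cases "Fb C le S = to_int f") (simp_all only: A_family_def A_semigroup_def mem_Collect_eq simp_thms)
  also have "\<dots> \<longleftrightarrow> submonoid S \<and> S \<subseteq> C \<and> f \<notin> S \<and> (\<forall>x\<in>C - S. le x f) \<and> ?A"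
    unfolding C_semigroup_iff_cofinite_submonoid[OF C]
    using Fb_eq_to_int_iff[OF le, of C S f] cofinite f by blast
  also have "\<dots> \<longleftrightarrow> ?R" by blast
  finally show ?thesis .
qed

theorem proposition2:
  fixes C :: "(nat ^ 'p) set"
    and le :: "nat ^ 'p \<Rightarrow> nat ^ 'p \<Rightarrow> bool"
    and f :: "nat ^ 'p"
  assumes "integer_cone C"
    and "card (extremal_rays C) \<ge> CARD('p)"
    and "monomial_order le"
    and "\<And>k. k \<in> C \<Longrightarrow> finite {x \<in> C. le x k}"
    and "f \<in> C - {0}"
  shows "covariety C le (A_family C le f)"
proof -
  note C = assms(1) and le = assms(3)
  have fin: "\<forall>k\<in>C. finite {x \<in> C. le x k}" using assms(4) by blast
  have f: "f \<in> C" "f \<noteq> 0" using assms(5) by auto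
  note ord = monomial_orderD[OF le]
  note mem = mem_A_family_iff[OF C le fin f(1)]
  define M where "M = insert 0 {x \<in> C. \<not> le x f}"
  have above: "\<not> le (x + y) f" if "\<not> le x f" for x y
    using that ord(3) monomial_order_summand[OF le] by blast
  have "submonoid M"
    using integer_cone_add[OF C] above by (auto simp: submonoid_def M_def)
  moreover have "(0 :: nat ^ 'p) \<notin> canonical_basis"
    by (auto simp: canonical_basis_def dest: sym)
  ultimately have M: "M \<in> A_family C le f"
    using f ord(1) integer_cone_0[OF C] unfolding mem by (auto simp: M_def)
  have min: "M \<subseteq> S" if "S \<in> A_family C le f" for S
    using that unfolding mem by (auto simp: M_def submonoid_def)
  have inter: "S \<inter> T \<in> A_family C le f"
    if "S \<in> A_family C le f" "T \<in> A_family C le f" for S T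
    using that unfolding mem by (auto simp: submonoid_def)
  have remove: "S - {multiplicity le S} \<in> A_family C le f"
    if S: "S \<in> A_family C le f" and ne: "S \<noteq> M" for S
  proof -
    define m where "m = multiplicity le S"
    have sub: "submonoid S" "S \<subseteq> C" using S unfolding mem by auto
    (* S has an element outside M, and such an element is nonzero and below f. *)
    obtain k where k: "k \<in> S - {0}" "le k f"
      using min[OF S] ne sub(2) by (auto simp: M_def)
    have "finite {x \<in> S. le x k}"
      by (rule finite_subset[OF _ bspec[OF fin, of k]]) (use k sub(2) in auto)
    note m = multiplicity_least[OF le this k(1), folded m_def]
    have "le m f" using m(2)[OF k(1)] k(2) ord(3) by blast
    have irred: "x + y \<noteq> m" if "x \<in> S - {m}" "y \<in> S - {m}" for x y
    proof
      assume xy: "x + y = m"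
      then have "x \<noteq> 0" using that(2) by auto
      then have "le m x" using m(2)[of x] that(1) by simp
      moreover have "le x m" using monomial_order_summand[OF le, of x y] xy by simp
      ultimately show False using that(1) ord(2)[of x m] by blast
    qed
    then have "submonoid (S - {m})"
      using sub(1) m(1) by (auto simp: submonoid_def)
    then show ?thesis
      using S \<open>le m f\<close> unfolding mem m_def[symmetric] by auto
  qed
  have semigroup: "C_semigroup C S" if "S \<in> A_family C le f" for S
    using that by (simp add: A_family_def A_semigroup_def)
  show ?thesis
    unfolding covariety_def
  proof (intro conjI bexI[OF _ M] ballI)
    show "A_family C le f \<noteq> {}" using M by blast
  qed (simp_all add: semigroup min inter remove)
qed

end
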